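(* Let $a,b\in\mathbb{R}$ and $f(x,y)=(x^4+y^4)+a\,x^2y^2-b(x^2y+xy^2)$. Then: (1) If $a\ge 22$, then $$f^*=-\frac{\bigl(a^2+14a+22+2(2a+5)\delta\bigr)b^4}{64(a-2)^3(a+2)},\qquad f^{\mathrm{SONC}}=-\frac{b^4}{8a^2},$$ where $\delta=\sqrt{5+2a}$. (2) If $4\le a\le 22$, then $f^*=-\dfrac{27b^4}{16(a+2)^3}$ and $f^{\mathrm{SONC}}=-\dfrac{b^4}{8a^2}$. (3) If $-2<a\le 4$, then $f^*=f^{\mathrm{SONC}}=-\dfrac{27b^4}{16(a+2)^3}$. (4) If $a\le -2$, then $f^*=f^{\mathrm{SONC}}=-\infty$, except for $a=-2$ and $b=0$, where $f^*=f^{\mathrm{SONC}}=0$.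
   Context: For a finite set $\mathcal{A}\subset\mathbb{N}^n$ and $\beta\in\mathbb{N}^n\setminus\mathcal{A}$ (with $0\in\mathbb{N}$), $C_{\mathrm{AG}}(\mathcal{A},\beta)$ is the set of polynomials $\sum_{\alpha\in\mathcal{A}}c_\alpha x^\alpha+c_\beta x^\beta$ with $c_\alpha\ge 0$ for $\alpha\in\mathcal{A}$, $c_\beta\in\mathbb{R}$, $c_\gamma=0$ for all $\gamma\in\mathcal{A}\setminus(2\mathbb{N})^n$, that are nonnegative on $\mathbb{R}^n$. For a nonempty finite set $\mathcal{T}\subset\mathbb{N}^n$, $C_{\mathrm{SONC}}(\mathcal{T})=\sum_{\beta\in\mathcal{T}}C_{\mathrm{AG}}(\mathcal{T}\setminus\{\beta\},\beta)$ (Minkowski sum). Here $n=2$. For a polynomial $f$, $f^*$ is the infimum of $f$ over $\mathbb{R}^n$ and $f^{\mathrm{SONC}}=\sup\{\lambda\in\mathbb{R}: f-\lambda\in C_{\mathrm{SONC}}(\mathcal{T})\}$, where $\mathcal{T}$ is the set of exponents occurring in $f$ together with $0$; the supremum of the empty set is $-\infty$. *)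

theory Defs
  imports "HOL-Analysis.Analysis" "HOL-Library.Poly_Mapping"
begin

text \<open>
  Polynomials in the variables indexed by \<open>'n\<close> are elements of the monoid algebra of
  the additive monoid \<open>nat ^ 'n\<close> of exponent vectors: \<open>keys\<close> is the support and
  \<open>lookup\<close> gives the coefficients.
\<close>

type_synonym 'n rpoly = "(nat ^ 'n) \<Rightarrow>\<^sub>0 real"

definition const_poly :: "real \<Rightarrow> 'n::finite rpoly" where
  "const_poly c = Poly_Mapping.single 0 c"

definition var_poly :: "'n \<Rightarrow> 'n::finite rpoly" where
  "var_poly i = Poly_Mapping.single (axis i 1) 1"

definition eval_poly :: "'n::finite rpoly \<Rightarrow> real ^ 'n \<Rightarrow> real" where
  "eval_poly p x =
     (\<Sum>\<alpha>\<in>Poly_Mapping.keys p. Poly_Mapping.lookup p \<alpha> * (\<Prod>i\<in>UNIV. (x $ i) ^ (\<alpha> $ i)))"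

text \<open>The set is meant for finite \<open>A\<close> and \<open>\<beta> \<notin> A\<close>.\<close>

definition C_AG :: "(nat ^ 'n) set \<Rightarrow> nat ^ 'n \<Rightarrow> 'n::finite rpoly set" where
  "C_AG A \<beta> =
     {p. Poly_Mapping.keys p \<subseteq> insert \<beta> A \<and>
         (\<forall>\<alpha>\<in>A. Poly_Mapping.lookup p \<alpha> \<ge> 0) \<and>
         (\<forall>\<gamma>\<in>A. \<not> (\<forall>i. even (\<gamma> $ i)) \<longrightarrow> Poly_Mapping.lookup p \<gamma> = 0) \<and>
         (\<forall>x. eval_poly p x \<ge> 0)}"

text \<open>A Minkowski sum over \<open>\<beta> \<in> T\<close>, for finite nonempty \<open>T\<close>.\<close>

definition C_SONC :: "(nat ^ 'n) set \<Rightarrow> 'n::finite rpoly set" where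
  "C_SONC T = {(\<Sum>\<beta>\<in>T. g \<beta>) | g. \<forall>\<beta>\<in>T. g \<beta> \<in> C_AG (T - {\<beta>}) \<beta>}"

text \<open>Both bounds are extended reals, with \<open>Sup {} = -\<infinity>\<close>.\<close>

definition poly_inf :: "'n::finite rpoly \<Rightarrow> ereal" where
  "poly_inf f = (INF x. ereal (eval_poly f x))"

definition sonc_bound :: "'n::finite rpoly \<Rightarrow> ereal" where
  "sonc_bound f =
     Sup (ereal ` {r. f - const_poly r \<in> C_SONC (insert 0 (Poly_Mapping.keys f))})"

definition quartic :: "real \<Rightarrow> real \<Rightarrow> 2 rpoly" where
  "quartic a b =
     (let x = var_poly 1; y = var_poly 2
      in (x ^ 4 + y ^ 4) + const_poly a * x ^ 2 * y ^ 2 - const_poly b * (x ^ 2 * y + x * y ^ 2))"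

end

theory Submission
  imports Defs
begin

text \<open>
  Write \<open>f\<close> for the quartic, \<open>s = x + y\<close> and \<open>p = x y\<close>, so that
  \<open>f = s\<^sup>4 - 4 s\<^sup>2 p + (a + 2) p\<^sup>2 - b p s\<close> with \<open>4 p \<le> s\<^sup>2\<close>.

  \<^bold>\<open>The infimum.\<close> For \<open>a > -2\<close> this is a convex quadratic in \<open>p\<close> once \<open>s\<close> is fixed. The minimum
  lies either on the diagonal \<open>4 p = s\<^sup>2\<close>, that is at \<open>x = y = t = 3 b / (2 (a + 2))\<close>, or at the
  vertex in \<open>p\<close> followed by a one-variable quartic in \<open>s\<close>; the two regimes meet at \<open>a = 22\<close>.
  On the diagonal side, with \<open>t\<close> as a parameter in place of \<open>b\<close>, the difference of \<open>f\<close> and its value at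
  \<open>(t, t)\<close> is affine in \<open>a\<close>, so nonnegativity is needed only at \<open>a = -2\<close> and \<open>a = 22\<close>
  (\<open>poly_inf_quartic_diagonal\<close>). Off the diagonal all data are rational in \<open>\<delta> = sqrt (5 + 2 a)\<close> and
  the minimiser has \<open>s = b / (2 (\<delta> - 3))\<close> (\<open>poly_inf_quartic_off_diagonal\<close>); for \<open>b \<noteq> 0\<close> it is real
  exactly when \<open>\<delta> \<ge> 7\<close>. For \<open>a \<le> -2\<close> the values on the diagonal are unbounded below, except when
  \<open>f = (x\<^sup>2 - y\<^sup>2)\<^sup>2\<close>.

  \<^bold>\<open>The SONC bound from below.\<close> The two odd monomials must go into different AG polynomials, which by
  symmetry can be taken to be mirror images of each other. If \<open>a \<le> 4\<close>, both pieces can be made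
  to vanish at the diagonal minimiser \<open>(t, t)\<close>, and the SONC bound reaches the infimum
  (\<open>sonc_bound_quartic_ge_small\<close>). The matching conditions would force a negative coefficient of \<open>y\<^sup>4\<close>
  next to \<open>x\<^sup>2 y\<close> when \<open>a > 4\<close>; the best choice is then to omit \<open>y\<^sup>4\<close>, which gives
  \<open>- b\<^sup>4 / (8 a\<^sup>2)\<close> (\<open>sonc_bound_quartic_ge_large\<close>).

  \<^bold>\<open>The SONC bound from above.\<close> It never exceeds the infimum (\<open>sonc_bound_le_poly_inf\<close>). For
  \<open>a \<ge> 4\<close> a linear functional separates \<open>f - r\<close> from the cone whenever \<open>r > - b\<^sup>4 / (8 a\<^sup>2)\<close>.
  It mixes the evaluations at the zeros \<open>(u, w)\<close> and \<open>(w, u)\<close> of the two optimal pieces, and its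
  nonnegativity on AG polynomials needs only \<open>\<bar>w\<bar> \<le> \<bar>u\<bar>\<close> (\<open>pseudo_eval_AG_nonneg\<close>), which for these zeros is
  \<open>a \<ge> 4\<close>.
\<close>

section \<open>Evaluation and the SONC cone\<close>

lemma eval_poly_superset:
  assumes "finite S" "Poly_Mapping.keys p \<subseteq> S"
  shows "eval_poly p x = (\<Sum>\<alpha>\<in>S. Poly_Mapping.lookup p \<alpha> * (\<Prod>i\<in>UNIV. (x $ i) ^ (\<alpha> $ i)))"
  unfolding eval_poly_def
  by (rule sum.mono_neutral_left) (use assms in \<open>auto simp: in_keys_iff\<close>)

lemma eval_poly_add: "eval_poly (p + q) x = eval_poly p x + eval_poly q x"
proof -
  let ?S = "Poly_Mapping.keys p \<union> Poly_Mapping.keys q"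
  have "eval_poly (p + q) x =
      (\<Sum>\<alpha>\<in>?S. Poly_Mapping.lookup (p + q) \<alpha> * (\<Prod>i\<in>UNIV. (x $ i) ^ (\<alpha> $ i)))"
    by (rule eval_poly_superset) (use keys_add[of p q] in auto)
  moreover have "eval_poly p x =
      (\<Sum>\<alpha>\<in>?S. Poly_Mapping.lookup p \<alpha> * (\<Prod>i\<in>UNIV. (x $ i) ^ (\<alpha> $ i)))"
    by (rule eval_poly_superset) auto
  moreover have "eval_poly q x =
      (\<Sum>\<alpha>\<in>?S. Poly_Mapping.lookup q \<alpha> * (\<Prod>i\<in>UNIV. (x $ i) ^ (\<alpha> $ i)))"
    by (rule eval_poly_superset) auto
  ultimately show ?thesis
    by (simp add: lookup_add distrib_right sum.distrib)
qed

lemma eval_poly_0 [simp]: "eval_poly 0 x = 0"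
  by (simp add: eval_poly_def)

lemma eval_poly_sum: "eval_poly (\<Sum>i\<in>I. g i) x = (\<Sum>i\<in>I. eval_poly (g i) x)"
  by (induction I rule: infinite_finite_induct) (simp_all add: eval_poly_add)

lemma lookup_sum: "Poly_Mapping.lookup (\<Sum>i\<in>I. g i) k = (\<Sum>i\<in>I. Poly_Mapping.lookup (g i) k)"
  by (induction I rule: infinite_finite_induct) (simp_all add: lookup_add)

lemma eval_const_poly [simp]: "eval_poly (const_poly c) x = c"
  by (cases "c = 0") (simp_all add: eval_poly_def const_poly_def)

lemma C_AG_0: "0 \<in> C_AG A \<beta>"
  by (simp add: C_AG_def)

lemma C_AG_add:
  assumes "p \<in> C_AG A \<beta>" "q \<in> C_AG A \<beta>"
  shows "p + q \<in> C_AG A \<beta>"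
  using assms keys_add[of p q] by (auto simp: C_AG_def lookup_add eval_poly_add)

lemma C_SONC_add:
  assumes "p \<in> C_SONC T" "q \<in> C_SONC T"
  shows "p + q \<in> C_SONC T"
proof -
  obtain g h where "p = (\<Sum>\<beta>\<in>T. g \<beta>)" "q = (\<Sum>\<beta>\<in>T. h \<beta>)"
    and "\<forall>\<beta>\<in>T. g \<beta> \<in> C_AG (T - {\<beta>}) \<beta>" "\<forall>\<beta>\<in>T. h \<beta> \<in> C_AG (T - {\<beta>}) \<beta>"
    using assms unfolding C_SONC_def by auto
  then show ?thesis
    unfolding C_SONC_def
    by (intro CollectI exI[of _ "\<lambda>\<beta>. g \<beta> + h \<beta>"]) (simp add: sum.distrib C_AG_add)
qed

lemma C_SONC_nonneg:
  assumes "p \<in> C_SONC T"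
  shows "eval_poly p x \<ge> 0"
  using assms unfolding C_SONC_def C_AG_def by (auto simp: eval_poly_sum intro!: sum_nonneg)

lemma sonc_bound_le_poly_inf: "sonc_bound f \<le> poly_inf f"
  unfolding sonc_bound_def poly_inf_def
proof (intro Sup_least INF_greatest)
  fix z x
  assume "z \<in> ereal ` {r. f - const_poly r \<in> C_SONC (insert 0 (Poly_Mapping.keys f))}"
  then obtain r where r: "z = ereal r" "f - const_poly r \<in> C_SONC (insert 0 (Poly_Mapping.keys f))"
    by auto
  have "eval_poly f x = eval_poly (f - const_poly r) x + r"
    using eval_poly_add[of "f - const_poly r" "const_poly r" x] by simp
  with C_SONC_nonneg[OF r(2)] r(1) show "z \<le> ereal (eval_poly f x)"
    by simp
qed

text \<open>
  When the distinguished exponent \<open>\<beta>\<close> of an AG polynomial lies outside \<open>T\<close>, its coefficient vanishes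
  and any other element of \<open>T\<close> can take its place. Dropping the condition \<open>\<beta> \<in> T\<close> lets
  one certificate serve all parameters, including those for which some monomials of the
  quartic disappear.
\<close>

lemma C_SONC_of_AG:
  assumes T: "finite T" "T \<noteq> {}" "Poly_Mapping.keys p \<subseteq> T"
    and pos: "\<And>\<gamma>. \<gamma> \<noteq> \<beta> \<Longrightarrow> Poly_Mapping.lookup p \<gamma> \<ge> 0"
    and ev: "\<And>\<gamma>. \<gamma> \<noteq> \<beta> \<Longrightarrow> Poly_Mapping.lookup p \<gamma> \<noteq> 0 \<Longrightarrow> \<forall>i. even (\<gamma> $ i)"
    and nonneg: "\<And>x. eval_poly p x \<ge> 0"
  shows "p \<in> C_SONC T"
proof -
  obtain \<beta>' where \<beta>': "\<beta>' \<in> T" "p \<in> C_AG (T - {\<beta>'}) \<beta>'"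
  proof (cases "\<beta> \<in> T")
    case True
    then have "p \<in> C_AG (T - {\<beta>}) \<beta>"
      using assms unfolding C_AG_def by blast
    with True show ?thesis using that by blast
  next
    case False
    then have "Poly_Mapping.lookup p \<beta> = 0"
      using T(3) by (auto simp: in_keys_iff)
    then have "Poly_Mapping.lookup p \<gamma> \<ge> 0 \<and>
        (\<not> (\<forall>i. even (\<gamma> $ i)) \<longrightarrow> Poly_Mapping.lookup p \<gamma> = 0)" for \<gamma>
      using pos[of \<gamma>] ev[of \<gamma>] by (cases "\<gamma> = \<beta>") auto
    moreover obtain \<beta>' where "\<beta>' \<in> T"
      using T(2) by blast
    ultimately have "p \<in> C_AG (T - {\<beta>'}) \<beta>'"
      using T(3) nonneg unfolding C_AG_def by blast
    with \<open>\<beta>' \<in> T\<close> show ?thesis using that by blast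
  qed
  then show ?thesis
    unfolding C_SONC_def
    by (intro CollectI exI[of _ "\<lambda>\<gamma>. if \<gamma> = \<beta>' then p else 0"])
      (use T(1) in \<open>auto simp: C_AG_0\<close>)
qed

lemma sonc_bound_ge:
  assumes "f - const_poly r \<in> C_SONC (insert 0 (Poly_Mapping.keys f))"
  shows "ereal r \<le> sonc_bound f"
  unfolding sonc_bound_def by (intro Sup_upper imageI CollectI assms)

section \<open>Polynomials with the six_term given monomials\<close>

definition expo :: "nat \<Rightarrow> nat \<Rightarrow> nat ^ 2" where
  "expo i j = (\<chi> k. if k = 1 then i else j)"

lemma expo_nth [simp]: "expo i j $ 1 = i" "expo i j $ 2 = j"
  by (simp_all add: expo_def)

lemma expo_eq_iff [simp]: "expo i j = expo k l \<longleftrightarrow> i = k \<and> j = l"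
  by (auto simp: vec_eq_iff forall_2)

lemma expo_add: "expo i j + expo k l = expo (i + k) (j + l)"
  by (simp add: vec_eq_iff forall_2)

lemma expo_0: "0 = expo 0 0"
  by (simp add: vec_eq_iff forall_2)

lemma axis_expo: "axis 1 (Suc 0) = expo (Suc 0) 0" "axis 2 (Suc 0) = expo 0 (Suc 0)"
  by (simp_all add: vec_eq_iff forall_2 axis_def)

definition support :: "(nat ^ 2) set" where
  "support = {expo 4 0, expo 0 4, expo 2 2, expo 2 1, expo 1 2, expo 0 0}"

definition six_term :: "real \<Rightarrow> real \<Rightarrow> real \<Rightarrow> real \<Rightarrow> real \<Rightarrow> real \<Rightarrow> 2 rpoly" where
  "six_term c40 c04 c22 c21 c12 c00 =
     Poly_Mapping.single (expo 4 0) c40 + Poly_Mapping.single (expo 0 4) c04 +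
     Poly_Mapping.single (expo 2 2) c22 + Poly_Mapping.single (expo 2 1) c21 +
     Poly_Mapping.single (expo 1 2) c12 + Poly_Mapping.single (expo 0 0) c00"

lemma lookup_six_term:
  "Poly_Mapping.lookup (six_term c40 c04 c22 c21 c12 c00) \<gamma> =
     (if \<gamma> = expo 4 0 then c40 else if \<gamma> = expo 0 4 then c04 else if \<gamma> = expo 2 2 then c22
      else if \<gamma> = expo 2 1 then c21 else if \<gamma> = expo 1 2 then c12
      else if \<gamma> = expo 0 0 then c00 else 0)"
  by (simp add: six_term_def lookup_add lookup_single when_def)

lemma keys_six_term:
  "\<gamma> \<in> Poly_Mapping.keys (six_term c40 c04 c22 c21 c12 c00) \<longleftrightarrow>
     \<gamma> = expo 4 0 \<and> c40 \<noteq> 0 \<or> \<gamma> = expo 0 4 \<and> c04 \<noteq> 0 \<or> \<gamma> = expo 2 2 \<and> c22 \<noteq> 0 \<or>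
     \<gamma> = expo 2 1 \<and> c21 \<noteq> 0 \<or> \<gamma> = expo 1 2 \<and> c12 \<noteq> 0 \<or> \<gamma> = expo 0 0 \<and> c00 \<noteq> 0"
  by (auto simp: in_keys_iff lookup_six_term)

lemma six_term_add:
  "six_term a1 a2 a3 a4 a5 a6 + six_term b1 b2 b3 b4 b5 b6 =
     six_term (a1 + b1) (a2 + b2) (a3 + b3) (a4 + b4) (a5 + b5) (a6 + b6)"
  by (simp add: six_term_def single_add algebra_simps)

lemma eval_support:
  assumes "Poly_Mapping.keys p \<subseteq> support"
  shows "eval_poly p v =
    Poly_Mapping.lookup p (expo 4 0) * (v $ 1) ^ 4 + Poly_Mapping.lookup p (expo 0 4) * (v $ 2) ^ 4 +
    Poly_Mapping.lookup p (expo 2 2) * (v $ 1)\<^sup>2 * (v $ 2)\<^sup>2 +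
    Poly_Mapping.lookup p (expo 2 1) * (v $ 1)\<^sup>2 * v $ 2 +
    Poly_Mapping.lookup p (expo 1 2) * v $ 1 * (v $ 2)\<^sup>2 + Poly_Mapping.lookup p (expo 0 0)"
proof -
  have "finite support" by (simp add: support_def)
  from eval_poly_superset[OF this assms] show ?thesis
    by (simp add: support_def UNIV_2)
qed

lemma eval_six_term:
  "eval_poly (six_term c40 c04 c22 c21 c12 c00) v =
     c40 * (v $ 1) ^ 4 + c04 * (v $ 2) ^ 4 + c22 * (v $ 1)\<^sup>2 * (v $ 2)\<^sup>2 +
     c21 * (v $ 1)\<^sup>2 * v $ 2 + c12 * v $ 1 * (v $ 2)\<^sup>2 + c00"
  by (subst eval_support) (auto simp: keys_six_term support_def lookup_six_term)

lemma const_poly_six_term: "const_poly c = six_term 0 0 0 0 0 c"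
  by (simp add: six_term_def const_poly_def expo_0)

lemma quartic_six_term: "quartic a b = six_term 1 1 a (- b) (- b) 0"
  by (simp add: quartic_def six_term_def Let_def var_poly_def const_poly_def axis_expo expo_0
      mult_single expo_add eval_nat_numeral right_diff_distrib distrib_left single_uminus diff_diff_eq [symmetric])

lemma quartic_minus_const: "quartic a b - const_poly r = six_term 1 1 a (- b) (- b) (- r)"
proof -
  have "six_term 1 1 a (- b) (- b) (- r) + const_poly r = quartic a b"
    by (simp add: quartic_six_term const_poly_six_term six_term_add)
  then show ?thesis by (simp add: algebra_simps)
qed

lemma eval_quartic:
  "eval_poly (quartic a b) v =
     (v $ 1) ^ 4 + (v $ 2) ^ 4 + a * (v $ 1)\<^sup>2 * (v $ 2)\<^sup>2 - b * (v $ 1 * v $ 2 * (v $ 1 + v $ 2))"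
  unfolding quartic_six_term eval_six_term by (simp add: algebra_simps power2_eq_square)

section \<open>An upper bound for the SONC bound\<close>

text \<open>
  Both \<open>x\<^sup>2 y\<close> and \<open>x y\<^sup>2\<close> receive the value of \<open>x\<^sup>2 y\<close> at \<open>(u, w)\<close>, although in general no point
  realises this: the value of \<open>x y\<^sup>2\<close> is the one at \<open>(w, u)\<close>. Both fourth powers receive the larger value
  \<open>u\<^sup>4\<close>.
\<close>

definition pseudo_eval :: "real \<Rightarrow> real \<Rightarrow> 2 rpoly \<Rightarrow> real" where
  "pseudo_eval u w p =
     u ^ 4 * (Poly_Mapping.lookup p (expo 4 0) + Poly_Mapping.lookup p (expo 0 4)) +
     u\<^sup>2 * w\<^sup>2 * Poly_Mapping.lookup p (expo 2 2) +
     u\<^sup>2 * w * (Poly_Mapping.lookup p (expo 2 1) + Poly_Mapping.lookup p (expo 1 2)) +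
     Poly_Mapping.lookup p (expo 0 0)"

lemma pseudo_eval_sum: "pseudo_eval u w (\<Sum>i\<in>I. g i) = (\<Sum>i\<in>I. pseudo_eval u w (g i))"
  by (simp add: pseudo_eval_def lookup_sum sum.distrib sum_distrib_left distrib_left)

text \<open>
  An AG polynomial contains at most one monomial that is odd or has a negative coefficient. If
  there is one, some genuine point evaluation bounds the functional from below: \<open>(u, w)\<close> for
  \<open>x\<^sup>2 y\<close>, \<open>(w, u)\<close> for \<open>x y\<^sup>2\<close>, \<open>(u, u)\<close> for \<open>x\<^sup>2 y\<^sup>2\<close> with a negative coefficient, and
  a point on the axes for the remaining ones. The functional gives that monomial its value at the
  point or, for \<open>x\<^sup>2 y\<^sup>2\<close>, a smaller one, and gives the other monomials at least their values there
  because \<open>\<bar>w\<bar> \<le> \<bar>u\<bar>\<close>.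
\<close>

lemma pseudo_eval_AG_nonneg:
  assumes w: "\<bar>w\<bar> \<le> \<bar>u\<bar>" and T: "T \<subseteq> support" "\<beta> \<in> T" and g: "g \<in> C_AG (T - {\<beta>}) \<beta>"
  shows "pseudo_eval u w g \<ge> 0"
proof -
  let ?c = "\<lambda>i j. Poly_Mapping.lookup g (expo i j)"
  have keys: "Poly_Mapping.keys g \<subseteq> support"
    using g T unfolding C_AG_def by blast
  have pos: "Poly_Mapping.lookup g \<gamma> \<ge> 0" if "\<gamma> \<noteq> \<beta>" for \<gamma>
    using g that in_keys_iff[of \<gamma> g] unfolding C_AG_def by (cases "\<gamma> \<in> T") auto
  have "Poly_Mapping.lookup g \<gamma> = 0" if "\<gamma> \<noteq> \<beta>" "\<not> (\<forall>i. even (\<gamma> $ i))" for \<gamma>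
    using g that in_keys_iff[of \<gamma> g] unfolding C_AG_def by (cases "\<gamma> \<in> T") auto
  from this[of "expo 2 1"] this[of "expo 1 2"]
  have c21: "\<beta> \<noteq> expo 2 1 \<Longrightarrow> ?c 2 1 = 0" and c12: "\<beta> \<noteq> expo 1 2 \<Longrightarrow> ?c 1 2 = 0"
    by (auto simp: forall_2)
  have val: "0 \<le> ?c 4 0 * x ^ 4 + ?c 0 4 * y ^ 4 + ?c 2 2 * x\<^sup>2 * y\<^sup>2 +
      ?c 2 1 * x\<^sup>2 * y + ?c 1 2 * x * y\<^sup>2 + ?c 0 0" for x y
  proof -
    have "0 \<le> eval_poly g (vector [x, y])"
      using g unfolding C_AG_def by blast
    then show ?thesis
      by (simp add: eval_support[OF keys])
  qed
  have sq: "w\<^sup>2 \<le> u\<^sup>2"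
    using w by (simp add: abs_le_square_iff)
  have e: "w ^ 4 = w\<^sup>2 * w\<^sup>2" "u ^ 4 = u\<^sup>2 * u\<^sup>2"
    by (simp_all flip: power_add)
  have w4: "w ^ 4 \<le> u ^ 4"
    unfolding e by (rule mult_mono[OF sq sq]) simp_all
  have uw: "u\<^sup>2 * w\<^sup>2 \<le> u ^ 4"
    unfolding e by (rule mult_left_mono[OF sq]) simp
  have L: "pseudo_eval u w g = u ^ 4 * ?c 4 0 + u ^ 4 * ?c 0 4 + u\<^sup>2 * w\<^sup>2 * ?c 2 2 +
      u\<^sup>2 * w * ?c 2 1 + u\<^sup>2 * w * ?c 1 2 + ?c 0 0"
    by (simp add: pseudo_eval_def distrib_left)
  have pm: "0 \<le> u ^ 4 * Poly_Mapping.lookup g \<gamma>" "0 \<le> u\<^sup>2 * w\<^sup>2 * Poly_Mapping.lookup g \<gamma>"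
    if "\<gamma> \<noteq> \<beta>" for \<gamma>
    using pos[OF that] by simp_all
  consider "\<beta> = expo 2 1" | "\<beta> = expo 1 2" | "\<beta> = expo 2 2" | "\<beta> = expo 4 0"
    | "\<beta> = expo 0 4" | "\<beta> = expo 0 0"
    using T unfolding support_def by blast
  then show ?thesis
  proof cases
    case 1
    have "?c 0 4 * w ^ 4 \<le> u ^ 4 * ?c 0 4"
      using mult_left_mono[OF w4 pos[of "expo 0 4"]] 1 by (simp add: mult.commute)
    then show ?thesis
      using val[of u w] c12 1 L by (simp add: algebra_simps)
  next
    case 2
    have "?c 4 0 * w ^ 4 \<le> u ^ 4 * ?c 4 0"
      using mult_left_mono[OF w4 pos[of "expo 4 0"]] 2 by (simp add: mult.commute)
    then show ?thesis
      using val[of w u] c21 2 L by (simp add: algebra_simps)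
  next
    case 3
    then have odd: "?c 2 1 = 0" "?c 1 2 = 0"
      using c21 c12 by auto
    have ge: "0 \<le> u ^ 4 * ?c 4 0" "0 \<le> u ^ 4 * ?c 0 4" "0 \<le> ?c 0 0"
      using 3 pos by auto
    show ?thesis
    proof (cases "?c 2 2 \<ge> 0")
      case True
      then have "0 \<le> u\<^sup>2 * w\<^sup>2 * ?c 2 2" by simp
      with ge odd L show ?thesis by simp
    next
      case False
      then have "?c 2 2 * u ^ 4 \<le> ?c 2 2 * (u\<^sup>2 * w\<^sup>2)"
        by (intro mult_left_mono_neg uw) simp
      moreover have "u\<^sup>2 * u\<^sup>2 = u ^ 4"
        by (simp add: power4_eq_xxxx power2_eq_square)
      ultimately show ?thesis
        using val[of u u] odd L by (simp add: algebra_simps)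
    qed
  next
    case 4
    then show ?thesis
      using val[of u 0] c21 c12 L pm[of "expo 0 4"] pm[of "expo 2 2"] by (simp add: algebra_simps)
  next
    case 5
    then show ?thesis
      using val[of 0 u] c21 c12 L pm[of "expo 4 0"] pm[of "expo 2 2"] by (simp add: algebra_simps)
  next
    case 6
    then show ?thesis
      using val[of 0 0] c21 c12 L pm[of "expo 4 0"] pm[of "expo 0 4"] pm[of "expo 2 2"]
      by simp
  qed
qed

lemma pseudo_eval_SONC_nonneg:
  assumes "\<bar>w\<bar> \<le> \<bar>u\<bar>" "T \<subseteq> support" "p \<in> C_SONC T"
  shows "pseudo_eval u w p \<ge> 0"
  using assms pseudo_eval_AG_nonneg unfolding C_SONC_def
  by (auto simp: pseudo_eval_sum intro!: sum_nonneg)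

lemma quartic_exponents_support: "insert 0 (Poly_Mapping.keys (quartic a b)) \<subseteq> support"
  by (auto simp: quartic_six_term keys_six_term support_def expo_0)

text \<open>
  The piece \<open>x\<^sup>4 + (a/2) x\<^sup>2 y\<^sup>2 - b x\<^sup>2 y + b\<^sup>4 / (16 a\<^sup>2)\<close> vanishes at
  \<open>x = b / (2 sqrt a)\<close>, \<open>y = b / a\<close>. These coordinates are the weights \<open>u\<close> and \<open>w\<close> for which the
  functional gives exactly \<open>- b\<^sup>4 / (8 a\<^sup>2)\<close> on the quartic.
\<close>

lemma sonc_bound_quartic_le:
  assumes "a \<ge> 4"
  shows "sonc_bound (quartic a b) \<le> ereal (- (b ^ 4 / (8 * a\<^sup>2)))"
  unfolding sonc_bound_def
proof (rule Sup_least)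
  fix z
  assume "z \<in> ereal ` {r. quartic a b - const_poly r
      \<in> C_SONC (insert 0 (Poly_Mapping.keys (quartic a b)))}"
  then obtain r where z: "z = ereal r"
    and r: "quartic a b - const_poly r \<in> C_SONC (insert 0 (Poly_Mapping.keys (quartic a b)))"
    by auto
  define s where "s = sqrt a"
  have s: "a = s\<^sup>2" "s \<ge> 2"
    using assms real_le_rsqrt[of 2 a] by (simp_all add: s_def)
  define u where "u = b / (2 * s)"
  have b: "b = 2 * s * u"
    using s by (simp add: u_def)
  have "\<bar>2 * u / s\<bar> \<le> \<bar>u\<bar>"
    using s mult_right_mono[of 2 s "\<bar>u\<bar>"] by (simp add: abs_mult field_simps)
  from pseudo_eval_SONC_nonneg[OF this quartic_exponents_support r]
  have "0 \<le> 2 * u ^ 4 + u\<^sup>2 * (2 * u / s)\<^sup>2 * a - 2 * (u\<^sup>2 * (2 * u / s)) * b - r"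
    by (simp add: quartic_minus_const pseudo_eval_def lookup_six_term algebra_simps)
  also have "\<dots> = - 2 * u ^ 4 - r"
    using s(2) unfolding s(1) b by (simp add: field_simps power2_eq_square power4_eq_xxxx)
  finally have "r \<le> - 2 * u ^ 4"
    by simp
  also have "\<dots> = - (b ^ 4 / (8 * a\<^sup>2))"
    using s(2) unfolding s(1) b by (simp add: field_simps power2_eq_square power4_eq_xxxx)
  finally show "z \<le> ereal (- (b ^ 4 / (8 * a\<^sup>2)))"
    by (simp add: z)
qed

section \<open>SONC certificates\<close>

text \<open>
  The two clauses of \<open>zero\<close> keep the piece inside the support of the quartic when a parameter vanishes.
  The clause \<open>one\<close> leaves at most one monomial for the role of the distinguished exponent.
\<close>

lemma quartic_piece_C_SONC:
  assumes T: "T = insert 0 (Poly_Mapping.keys (quartic a b))"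
    and zero: "a = 0 \<longrightarrow> c22 = 0" "b = 0 \<longrightarrow> c21 = 0 \<and> c12 = 0"
    and pos: "c40 \<ge> 0" "c04 \<ge> 0" "c00 \<ge> 0"
    and one: "c22 \<ge> 0 \<and> (c21 = 0 \<or> c12 = 0) \<or> c21 = 0 \<and> c12 = 0"
    and nonneg: "\<And>x y. 0 \<le> c40 * x ^ 4 + c04 * y ^ 4 + c22 * x\<^sup>2 * y\<^sup>2 +
      c21 * x\<^sup>2 * y + c12 * x * y\<^sup>2 + c00"
  shows "six_term c40 c04 c22 c21 c12 c00 \<in> C_SONC T"
proof (rule C_SONC_of_AG[where \<beta> = "if c22 < 0 then expo 2 2 else if c21 = 0 then expo 1 2 else expo 2 1"])
  show "finite T" "T \<noteq> {}"
    by (simp_all add: T)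
  show "Poly_Mapping.keys (six_term c40 c04 c22 c21 c12 c00) \<subseteq> T"
    using zero by (auto simp: T quartic_six_term keys_six_term expo_0)
  show "eval_poly (six_term c40 c04 c22 c21 c12 c00) x \<ge> 0" for x
    unfolding eval_six_term by (rule nonneg)
qed (use pos one in \<open>auto simp: lookup_six_term forall_2 split: if_splits\<close>)

text \<open>
  For \<open>a \<ge> 0\<close> each piece takes half of \<open>a x\<^sup>2 y\<^sup>2\<close>, and vanishing to first order at \<open>(t, t)\<close>
  determines its coefficients \<open>p\<close>, \<open>q\<close>; the coefficient \<open>q = 1/3 - a/12\<close> is nonnegative exactly when
  \<open>a \<le> 4\<close>. For \<open>a < 0\<close> the square \<open>(-a/2) (x\<^sup>2 - y\<^sup>2)\<^sup>2\<close> absorbs the negative term first, and what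
  is left is a multiple of the case \<open>a = 0\<close>. The equation for \<open>b\<close> avoids the division by \<open>a + 2\<close>,
  so \<open>a = -2\<close>, \<open>b = 0\<close> is included.
\<close>

lemma sonc_bound_quartic_ge_small:
  assumes a: "- 2 \<le> a" "a \<le> 4" and b: "3 * b = 2 * (a + 2) * t"
  shows "ereal (- ((a + 2) * t ^ 4 / 3)) \<le> sonc_bound (quartic a b)"
proof (rule sonc_bound_ge, unfold quartic_minus_const)
  define T where "T = insert 0 (Poly_Mapping.keys (quartic a b))"
  have b': "b = 2 * (a + 2) * t / 3"
    using b by simp
  show "six_term 1 1 a (- b) (- b) (- (- ((a + 2) * t ^ 4 / 3))) \<in> C_SONC T"
  proof (cases "a \<ge> 0")
    case True
    define p q where "p = 2 / 3 + a / 12" and "q = 1 / 3 - a / 12"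
    have pq: "p \<ge> 0" "q \<ge> 0" "(a + 2) * t ^ 4 / 6 \<ge> 0"
      using True a by (simp_all add: p_def q_def)
    \<comment> \<open>The piece is affine in \<open>a\<close>, so it interpolates between sums of squares for \<open>a = 0\<close> and \<open>a = 4\<close>.\<close>
    have sos: "0 \<le> p * x ^ 4 + q * y ^ 4 + a / 2 * x\<^sup>2 * y\<^sup>2 - b * x\<^sup>2 * y + (a + 2) * t ^ 4 / 6"
      for x y :: real
    proof -
      have "p * x ^ 4 + q * y ^ 4 + a / 2 * x\<^sup>2 * y\<^sup>2 - b * x\<^sup>2 * y + (a + 2) * t ^ 4 / 6 =
          (1 - a / 4) * (2 / 3 * (x\<^sup>2 - t * y)\<^sup>2 + 1 / 3 * (y\<^sup>2 - t\<^sup>2)\<^sup>2) +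
          a / 4 * ((x\<^sup>2 - t\<^sup>2)\<^sup>2 + 2 * x\<^sup>2 * (y - t)\<^sup>2)"
        unfolding p_def q_def b' by (simp add: field_simps power2_eq_square power4_eq_xxxx)
      also have "\<dots> \<ge> 0"
        using True a by (intro add_nonneg_nonneg mult_nonneg_nonneg) auto
      finally show ?thesis .
    qed
    have "six_term p q (a / 2) (- b) 0 ((a + 2) * t ^ 4 / 6) \<in> C_SONC T"
      using sos pq True by (intro quartic_piece_C_SONC[OF T_def]) auto
    moreover have "six_term q p (a / 2) 0 (- b) ((a + 2) * t ^ 4 / 6) \<in> C_SONC T"
    proof (rule quartic_piece_C_SONC[OF T_def])
      show "0 \<le> q * x ^ 4 + p * y ^ 4 + a / 2 * x\<^sup>2 * y\<^sup>2 + 0 * x\<^sup>2 * y + - b * x * y\<^sup>2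
          + (a + 2) * t ^ 4 / 6" for x y
        using sos[of y x] by (simp add: algebra_simps)
    qed (use pq True in auto)
    ultimately show ?thesis
      using C_SONC_add six_term_add[of p q "a / 2" "- b" 0 "(a + 2) * t ^ 4 / 6"
          q p "a / 2" 0 "- b" "(a + 2) * t ^ 4 / 6"]
      by (fastforce simp: p_def q_def)
  next
    case False
    define p q where "p = (a + 2) / 3" and "q = (a + 2) / 6"
    have pq: "p \<ge> 0" "q \<ge> 0" "(a + 2) * t ^ 4 / 6 \<ge> 0"
      using a by (simp_all add: p_def q_def)
    have sos: "0 \<le> p * x ^ 4 + q * y ^ 4 - b * x\<^sup>2 * y + (a + 2) * t ^ 4 / 6" for x y :: real
    proof -
      have "p * x ^ 4 + q * y ^ 4 - b * x\<^sup>2 * y + (a + 2) * t ^ 4 / 6 =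
          (a + 2) * (1 / 3 * (x\<^sup>2 - t * y)\<^sup>2 + 1 / 6 * (y\<^sup>2 - t\<^sup>2)\<^sup>2)"
        unfolding p_def q_def b' by (simp add: field_simps power2_eq_square power4_eq_xxxx)
      also have "\<dots> \<ge> 0"
        using a by simp
      finally show ?thesis .
    qed
    have "six_term p q 0 (- b) 0 ((a + 2) * t ^ 4 / 6) \<in> C_SONC T"
      using sos pq by (intro quartic_piece_C_SONC[OF T_def]) auto
    moreover have "six_term q p 0 0 (- b) ((a + 2) * t ^ 4 / 6) \<in> C_SONC T"
    proof (rule quartic_piece_C_SONC[OF T_def])
      show "0 \<le> q * x ^ 4 + p * y ^ 4 + 0 * x\<^sup>2 * y\<^sup>2 + 0 * x\<^sup>2 * y + - b * x * y\<^sup>2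
          + (a + 2) * t ^ 4 / 6" for x y
        using sos[of y x] by (simp add: algebra_simps)
    qed (use pq in auto)
    ultimately have "six_term (p + q) (p + q) 0 (- b) (- b) ((a + 2) * t ^ 4 / 3) \<in> C_SONC T"
      using C_SONC_add six_term_add[of p q 0 "- b" 0 "(a + 2) * t ^ 4 / 6"
          q p 0 0 "- b" "(a + 2) * t ^ 4 / 6"]
      by (fastforce simp: p_def q_def)
    moreover have "six_term (- a / 2) (- a / 2) a 0 0 0 \<in> C_SONC T"
    proof (rule quartic_piece_C_SONC[OF T_def])
      show "0 \<le> - a / 2 * x ^ 4 + - a / 2 * y ^ 4 + a * x\<^sup>2 * y\<^sup>2 + 0 * x\<^sup>2 * y + 0 * x * y\<^sup>2 + 0"
        for x y :: real
      proof -
        have "0 \<le> - a / 2 * (x\<^sup>2 - y\<^sup>2)\<^sup>2"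
          using False by (intro mult_nonneg_nonneg) auto
        then show ?thesis
          by (simp add: field_simps power2_eq_square power4_eq_xxxx)
      qed
    qed (use False in auto)
    ultimately show ?thesis
      using C_SONC_add six_term_add[of "p + q" "p + q" 0 "- b" "- b" "(a + 2) * t ^ 4 / 3"
          "- a / 2" "- a / 2" a 0 0 0]
      by (fastforce simp: p_def q_def field_simps)
  qed
qed

text \<open>
  Each piece contains only one fourth power, and hence is a square plus a multiple of
  \<open>x\<^sup>2 (y - b/a)\<^sup>2\<close> or its mirror image: the minimum over \<open>y\<close> is at \<open>y = b / a\<close> for every \<open>x\<close>.
\<close>

lemma sonc_bound_quartic_ge_large:
  assumes "a > 0"
  shows "ereal (- (b ^ 4 / (8 * a\<^sup>2))) \<le> sonc_bound (quartic a b)"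
proof (rule sonc_bound_ge, unfold quartic_minus_const)
  define T where "T = insert 0 (Poly_Mapping.keys (quartic a b))"
  define c where "c = b ^ 4 / (16 * a\<^sup>2)"
  have c: "c \<ge> 0"
    by (simp add: c_def)
  have sos: "0 \<le> x ^ 4 + a / 2 * x\<^sup>2 * y\<^sup>2 - b * x\<^sup>2 * y + c" for x y :: real
  proof -
    have "x ^ 4 + a / 2 * x\<^sup>2 * y\<^sup>2 - b * x\<^sup>2 * y + c =
        (x\<^sup>2 - b\<^sup>2 / (4 * a))\<^sup>2 + a / 2 * x\<^sup>2 * (y - b / a)\<^sup>2"
      unfolding c_def using assms by (simp add: field_simps power2_eq_square power4_eq_xxxx)
    also have "\<dots> \<ge> 0"
      using assms by (intro add_nonneg_nonneg mult_nonneg_nonneg) auto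
    finally show ?thesis .
  qed
  have "six_term 1 0 (a / 2) (- b) 0 c \<in> C_SONC T"
    using sos c assms by (intro quartic_piece_C_SONC[OF T_def]) auto
  moreover have "six_term 0 1 (a / 2) 0 (- b) c \<in> C_SONC T"
  proof (rule quartic_piece_C_SONC[OF T_def])
    show "0 \<le> 0 * x ^ 4 + 1 * y ^ 4 + a / 2 * x\<^sup>2 * y\<^sup>2 + 0 * x\<^sup>2 * y + - b * x * y\<^sup>2 + c" for x y
      using sos[of y x] by (simp add: algebra_simps)
  qed (use c assms in auto)
  ultimately show "six_term 1 1 a (- b) (- b) (- (- (b ^ 4 / (8 * a\<^sup>2)))) \<in> C_SONC T"
    using C_SONC_add six_term_add[of 1 0 "a / 2" "- b" 0 c 0 1 "a / 2" 0 "- b" c]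
    by (fastforce simp: c_def)
qed

section \<open>The infimum\<close>

lemma poly_inf_eqI:
  assumes "\<And>x. m \<le> eval_poly f x" "eval_poly f x0 = m"
  shows "poly_inf f = ereal m"
  unfolding poly_inf_def
  by (rule antisym) (use assms in \<open>auto intro!: INF_lower2[of x0] INF_greatest\<close>)

text \<open>
  For fixed \<open>t\<close> the difference \<open>f - f(t, t)\<close> equals \<open>(x\<^sup>2 - y\<^sup>2)\<^sup>2 + (a + 2) g\<close>, where
  \<open>g = x\<^sup>2 y\<^sup>2 - (2/3) t x y (x + y) + t\<^sup>4 / 3\<close> is independent of \<open>a\<close>. Nonnegativity at
  both ends of an interval of values of \<open>a\<close> therefore gives it on the whole interval.
\<close>

lemma poly_inf_quartic_diagonal:
  assumes a: "- 2 \<le> a" "a \<le> 22" and b: "3 * b = 2 * (a + 2) * t"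
  shows "poly_inf (quartic a b) = ereal (- ((a + 2) * t ^ 4 / 3))"
proof (rule poly_inf_eqI)
  have b': "b = 2 * (a + 2) * t / 3"
    using b by simp
  show "eval_poly (quartic a b) (vector [t, t]) = - ((a + 2) * t ^ 4 / 3)"
    unfolding eval_quartic b' by (simp add: field_simps power2_eq_square power4_eq_xxxx)
  fix v :: "real ^ 2"
  define x y where "x = v $ 1" and "y = v $ 2"
  define s p where "s = x + y" and "p = x * y"
  \<comment> \<open>The position of \<open>a\<close> between \<open>-2\<close> and \<open>22\<close>. At \<open>-2\<close> the difference is \<open>(x\<^sup>2 - y\<^sup>2)\<^sup>2\<close>; at \<open>22\<close>,
    completing the square in \<open>p\<close> leaves a quartic in \<open>s\<close> with a double root at \<open>2 t\<close>.\<close>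
  define k where "k = (a + 2) / 24"
  have k: "0 \<le> k" "k \<le> 1"
    using a by (simp_all add: k_def)
  define r where "r = 5 * s\<^sup>2 + 12 * s * t + 12 * t\<^sup>2"
  have "0 \<le> r"
  proof -
    have "r = 2 * s\<^sup>2 + 3 * (s + 2 * t)\<^sup>2"
      unfolding r_def by (simp add: field_simps power2_eq_square)
    also have "\<dots> \<ge> 0" by simp
    finally show ?thesis .
  qed
  then have "0 \<le> (1 - k) * (x\<^sup>2 - y\<^sup>2)\<^sup>2 + k * (((24 * p - 2 * s\<^sup>2 - 8 * s * t)\<^sup>2 +
      4 * ((s - 2 * t)\<^sup>2 * r)) / 24)"
    using k by (intro add_nonneg_nonneg mult_nonneg_nonneg divide_nonneg_pos) auto
  also have "\<dots> = x ^ 4 + y ^ 4 + a * x\<^sup>2 * y\<^sup>2 - b * (x * y * (x + y)) + (a + 2) * t ^ 4 / 3"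
    unfolding k_def r_def s_def p_def b' by (simp add: field_simps power2_eq_square power4_eq_xxxx)
  finally show "- ((a + 2) * t ^ 4 / 3) \<le> eval_poly (quartic a b) v"
    unfolding eval_quartic x_def y_def by simp
qed

text \<open>
  Here \<open>d\<close> stands for \<open>\<delta>\<close>, so \<open>a + 2 = (d\<^sup>2 - 1) / 2\<close>. Completing the square in \<open>p\<close> leaves a
  quartic in \<open>s\<close> whose derivative vanishes at \<open>0\<close> and at \<open>b / (2 (d - 3))\<close>, \<open>- b / (2 (d + 3))\<close>;
  the first of the two nonzero critical points is the minimiser \<open>s0\<close>, and subtracting the value there
  leaves the factor \<open>(s - s0)\<^sup>2\<close> and a positive quadratic. The optimal \<open>p = 2 s0\<^sup>2 / (d + 1)\<close> is
  a product of two real numbers with sum \<open>s0\<close> because \<open>d \<ge> 7\<close>.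
\<close>

lemma poly_inf_quartic_off_diagonal:
  assumes d: "d \<ge> 7" and a: "2 * a = d\<^sup>2 - 5"
  shows "poly_inf (quartic a b) = ereal (- (b ^ 4 / (16 * (d - 3) ^ 3 * (d + 1))))"
proof -
  define s0 where "s0 = b / (2 * (d - 3))"
  have b: "b = 2 * (d - 3) * s0"
    using d by (simp add: s0_def)
  have a': "a = (d\<^sup>2 - 5) / 2"
    using a by simp
  \<comment> \<open>The minimisers are \<open>s0 (1 \<plusminus> k) / 2\<close>: the discriminant \<open>s0\<^sup>2 - 4 p\<close> is \<open>s0\<^sup>2 (d - 7) / (d + 1)\<close>.\<close>
  define k where "k = sqrt ((d - 7) / (d + 1))"
  have k: "k\<^sup>2 = (d - 7) / (d + 1)"
    using d by (simp add: k_def)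
  have "16 * (d - 3) ^ 3 * (d + 1) * ((d - 3) * s0 ^ 4) = b ^ 4 * (d + 1)"
    unfolding b by (simp only: power_mult_distrib power3_eq_cube power4_eq_xxxx) algebra
  then have eq: "b ^ 4 * (d + 1) = (d - 3) * s0 ^ 4 * (16 * (d - 3) ^ 3 * (d + 1))"
    by (simp only: mult.commute)
  have nz: "16 * (d - 3) ^ 3 * (d + 1) \<noteq> 0" "d + 1 \<noteq> 0"
    using d by auto
  have val: "b ^ 4 / (16 * (d - 3) ^ 3 * (d + 1)) = (d - 3) * s0 ^ 4 / (d + 1)"
    using eq by (simp only: frac_eq_eq[OF nz])
  show ?thesis
    unfolding val
  proof (rule poly_inf_eqI)
    define x where "x = s0 * (1 + k) / 2"
    define y where "y = s0 * (1 - k) / 2"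
    have "x + y = s0"
      by (simp add: x_def y_def field_simps)
    have "x * y = s0\<^sup>2 * (1 - k\<^sup>2) / 4"
      by (simp add: x_def y_def field_simps power2_eq_square)
    also have "1 - k\<^sup>2 = 8 / (d + 1)"
      using d unfolding k by (simp add: field_simps)
    also have "s0\<^sup>2 * (8 / (d + 1)) / 4 = 2 * (s0\<^sup>2 / (d + 1))"
      using d by (simp add: field_simps)
    finally have xy: "x * y = 2 * (s0\<^sup>2 / (d + 1))" .
    define m where "m = s0\<^sup>2 / (d + 1)"
    have m: "s0\<^sup>2 = m * (d + 1)"
      using d by (simp add: m_def)
    have s04: "s0 ^ 4 = (m * (d + 1))\<^sup>2"
      by (simp flip: m)
    have "eval_poly (quartic a b) (vector [x, y]) =
        (x + y) ^ 4 - 4 * (x + y)\<^sup>2 * (x * y) + (a + 2) * (x * y)\<^sup>2 - b * ((x * y) * (x + y))"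
      unfolding eval_quartic by (simp add: field_simps power2_eq_square power4_eq_xxxx)
    also have "\<dots> = - ((d - 3) * s0 ^ 4 / (d + 1))"
    proof -
      have "b * (2 * m * s0) = 4 * (d - 3) * m * s0\<^sup>2"
        unfolding b by (simp add: power2_eq_square)
      moreover have "(m * (d + 1))\<^sup>2 - 4 * (m * (d + 1)) * (2 * m) + (a + 2) * (2 * m)\<^sup>2
          - 4 * (d - 3) * m * (m * (d + 1)) = - ((d - 3) * (m\<^sup>2 * (d + 1)))"
        unfolding a' by (simp add: field_simps power2_eq_square)
      moreover have "(d - 3) * (m * (d + 1))\<^sup>2 / (d + 1) = (d - 3) * (m\<^sup>2 * (d + 1))"
        using d by (simp add: power_mult_distrib power2_eq_square)
      ultimately show ?thesis
        unfolding xy m_def [symmetric] \<open>x + y = s0\<close> s04 by (simp only: m)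
    qed
    finally show "eval_poly (quartic a b) (vector [x, y]) = - ((d - 3) * s0 ^ 4 / (d + 1))" .
  next
    fix v :: "real ^ 2"
    define x y where "x = v $ 1" and "y = v $ 2"
    define s p where "s = x + y" and "p = x * y"
    have A: "d\<^sup>2 - 1 = (d - 1) * (d + 1)"
      by (simp add: algebra_simps power2_eq_square)
    define r where "r = (d + 3) * s\<^sup>2 + (2 * d - 2) * s * s0 + (d - 1) * s0\<^sup>2"
    have "0 \<le> r"
    proof -
      have "r = 4 * s\<^sup>2 + (d - 1) * (s + s0)\<^sup>2"
        by (simp add: r_def algebra_simps power2_eq_square)
      also have "\<dots> \<ge> 0"
        using d by simp
      finally show ?thesis .
    qed
    then have "0 \<le> ((d\<^sup>2 - 1) * p - 2 * (2 * s\<^sup>2 + (d - 3) * s0 * s))\<^sup>2 +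
        2 * ((d - 3) * (s - s0)\<^sup>2 * r)"
      using d by (intro add_nonneg_nonneg mult_nonneg_nonneg) auto
    also have "\<dots> = 2 * ((d\<^sup>2 - 1) * (s ^ 4 - 4 * s\<^sup>2 * p + (a + 2) * p\<^sup>2 - b * (p * s)) +
        (d - 1) * ((d - 3) * s0 ^ 4))"
      using a b unfolding r_def by algebra
    also have "s ^ 4 - 4 * s\<^sup>2 * p + (a + 2) * p\<^sup>2 - b * (p * s) = eval_poly (quartic a b) v"
      unfolding eval_quartic x_def [symmetric] y_def [symmetric] s_def p_def
      by (simp add: field_simps power2_eq_square power4_eq_xxxx)
    finally have "0 \<le> 2 * ((d - 1) * ((d + 1) * eval_poly (quartic a b) v + (d - 3) * s0 ^ 4))"
      unfolding A
      by (simp only: mult.assoc distrib_left[of "d - 1" "(d + 1) * eval_poly (quartic a b) v"])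
    then have "0 \<le> (d + 1) * eval_poly (quartic a b) v + (d - 3) * s0 ^ 4"
      using d by (simp add: zero_le_mult_iff)
    then show "- ((d - 3) * s0 ^ 4 / (d + 1)) \<le> eval_poly (quartic a b) v"
      using d by (simp add: field_simps)
  qed
qed

text \<open>
  At \<open>(x, x)\<close> the value is \<open>(a + 2) x\<^sup>4 - 2 b x\<^sup>3\<close>; with \<open>x\<close> of the sign of \<open>b\<close> neither term is
  positive and at least one is negative.
\<close>

lemma poly_inf_quartic_unbounded:
  assumes "a \<le> - 2" "\<not> (a = - 2 \<and> b = 0)"
  shows "poly_inf (quartic a b) = - \<infinity>"
proof -
  define k where "k = 2 * \<bar>b\<bar> - (a + 2)"
  have k: "k > 0"
    using assms by (auto simp: k_def)
  have "poly_inf (quartic a b) \<le> ereal r" for r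
  proof -
    define u where "u = max 1 (\<bar>r\<bar> / k)"
    define x where "x = (if b \<ge> 0 then u else - u)"
    have u: "u \<ge> 1" "\<bar>r\<bar> \<le> k * u"
      using k by (auto simp: u_def max_def field_simps)
    have powers: "u \<le> u ^ 3" "u \<le> u ^ 4"
      using u(1) power_increasing[of 1 3 u] power_increasing[of 1 4 u] by auto
    have "eval_poly (quartic a b) (vector [x, x]) = (a + 2) * u ^ 4 - 2 * \<bar>b\<bar> * u ^ 3"
      unfolding eval_quartic x_def
      by (simp add: algebra_simps power2_eq_square power3_eq_cube power4_eq_xxxx)
    also have "\<dots> \<le> (a + 2) * u - 2 * \<bar>b\<bar> * u"
      using powers assms(1) by (intro diff_mono mult_left_mono mult_left_mono_neg) auto
    also have "\<dots> = - (k * u)"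
      by (simp add: k_def algebra_simps)
    also have "\<dots> \<le> r"
      using u(2) by linarith
    finally show ?thesis
      unfolding poly_inf_def by (intro INF_lower2[of "vector [x, x]"]) auto
  qed
  then show ?thesis
    using ereal_bot by blast
qed


section \<open>The closed forms\<close>

lemma minimum_in_b:
  fixes a b :: real
  assumes "a > - 2"
  shows "(a + 2) * (3 * b / (2 * (a + 2))) ^ 4 / 3 = 27 * b ^ 4 / (16 * (a + 2) ^ 3)"
proof -
  have "c * (3 * b / (2 * c)) ^ 4 / 3 = 27 * b ^ 4 / (16 * c ^ 3)" if "c > 0" for c
    using that by (simp add: field_simps power3_eq_cube power4_eq_xxxx)
  from this[of "a + 2"] show ?thesis
    using assms by linarith
qed

lemma off_diagonal_minimum_in_a:
  fixes a b d :: real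
  assumes d: "d > 3" and a: "2 * a = d\<^sup>2 - 5"
  shows "(a ^ 2 + 14 * a + 22 + 2 * (2 * a + 5) * d) * b ^ 4 / (64 * (a - 2) ^ 3 * (a + 2)) =
    b ^ 4 / (16 * (d - 3) ^ 3 * (d + 1))"
proof -
  have a': "a = (d\<^sup>2 - 5) / 2"
    using a by simp
  have num: "a ^ 2 + 14 * a + 22 + 2 * (2 * a + 5) * d = (d + 3) ^ 3 * (d - 1) / 4"
    unfolding a' by (simp add: field_simps power2_eq_square power3_eq_cube)
  have fac: "a - 2 = (d - 3) * (d + 3) / 2" "a + 2 = (d - 1) * (d + 1) / 2"
    unfolding a' by (simp_all add: field_simps power2_eq_square)
  have "(d + 3) ^ 3 * (d - 1) \<noteq> 0"
    using d by simp
  have "64 * (a - 2) ^ 3 * (a + 2) = 16 * (d - 3) ^ 3 * (d + 1) * ((d + 3) ^ 3 * (d - 1) / 4)"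
    unfolding fac by (simp add: power_mult_distrib power_divide)
  then show ?thesis
    using \<open>(d + 3) ^ 3 * (d - 1) \<noteq> 0\<close> unfolding num by (simp only:) simp
qed

theorem proposition4p7:
  fixes a b :: real
  shows
    "(a \<ge> 22 \<longrightarrow>
        (let \<delta> = sqrt (5 + 2 * a) in
           poly_inf (quartic a b) =
             ereal (- (((a ^ 2 + 14 * a + 22 + 2 * (2 * a + 5) * \<delta>) * b ^ 4)
                      / (64 * (a - 2) ^ 3 * (a + 2))))) \<and>
        sonc_bound (quartic a b) = ereal (- (b ^ 4 / (8 * a ^ 2)))) \<and>
     (4 \<le> a \<and> a \<le> 22 \<longrightarrow>
        poly_inf (quartic a b) = ereal (- (27 * b ^ 4 / (16 * (a + 2) ^ 3))) \<and>
        sonc_bound (quartic a b) = ereal (- (b ^ 4 / (8 * a ^ 2)))) \<and>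
     (- 2 < a \<and> a \<le> 4 \<longrightarrow>
        poly_inf (quartic a b) = ereal (- (27 * b ^ 4 / (16 * (a + 2) ^ 3))) \<and>
        sonc_bound (quartic a b) = ereal (- (27 * b ^ 4 / (16 * (a + 2) ^ 3)))) \<and>
     (a \<le> - 2 \<longrightarrow>
        (if a = - 2 \<and> b = 0
         then poly_inf (quartic a b) = 0 \<and> sonc_bound (quartic a b) = 0
         else poly_inf (quartic a b) = - \<infinity> \<and> sonc_bound (quartic a b) = - \<infinity>))"
proof (intro conjI impI)
  have diag: "poly_inf (quartic a b) = ereal (- (27 * b ^ 4 / (16 * (a + 2) ^ 3)))"
    if "- 2 < a" "a \<le> 22"
    using poly_inf_quartic_diagonal[of a b "3 * b / (2 * (a + 2))"] that
      minimum_in_b[of a b] by simp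
  have sonc: "sonc_bound (quartic a b) = ereal (- (b ^ 4 / (8 * a ^ 2)))" if "a \<ge> 4"
    using that by (intro antisym sonc_bound_quartic_le sonc_bound_quartic_ge_large) auto
  show "let \<delta> = sqrt (5 + 2 * a) in
      poly_inf (quartic a b) =
        ereal (- (((a ^ 2 + 14 * a + 22 + 2 * (2 * a + 5) * \<delta>) * b ^ 4)
                 / (64 * (a - 2) ^ 3 * (a + 2))))" if "a \<ge> 22"
  proof -
    have d: "sqrt (5 + 2 * a) \<ge> 7" "2 * a = (sqrt (5 + 2 * a))\<^sup>2 - 5"
      using that real_le_rsqrt[of 7 "5 + 2 * a"] by simp_all
    then have "sqrt (5 + 2 * a) > 3"
      by linarith
    from poly_inf_quartic_off_diagonal[OF d] off_diagonal_minimum_in_a[OF this d(2)]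
    show ?thesis
      unfolding Let_def by (simp only:)
  qed
  show "sonc_bound (quartic a b) = ereal (- (b ^ 4 / (8 * a ^ 2)))" if "a \<ge> 22"
    using sonc that by simp
  show "poly_inf (quartic a b) = ereal (- (27 * b ^ 4 / (16 * (a + 2) ^ 3)))"
    and "sonc_bound (quartic a b) = ereal (- (b ^ 4 / (8 * a ^ 2)))" if "4 \<le> a \<and> a \<le> 22"
    using diag sonc that by auto
  show "poly_inf (quartic a b) = ereal (- (27 * b ^ 4 / (16 * (a + 2) ^ 3)))"
    and "sonc_bound (quartic a b) = ereal (- (27 * b ^ 4 / (16 * (a + 2) ^ 3)))"
    if "- 2 < a \<and> a \<le> 4"
  proof -
    show inf: "poly_inf (quartic a b) = ereal (- (27 * b ^ 4 / (16 * (a + 2) ^ 3)))"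
      using diag that by auto
    have "ereal (- (27 * b ^ 4 / (16 * (a + 2) ^ 3))) \<le> sonc_bound (quartic a b)"
      using sonc_bound_quartic_ge_small[of a b "3 * b / (2 * (a + 2))"] that
        minimum_in_b[of a b] by simp
    then show "sonc_bound (quartic a b) = ereal (- (27 * b ^ 4 / (16 * (a + 2) ^ 3)))"
      using sonc_bound_le_poly_inf[of "quartic a b"] inf by (intro antisym) auto
  qed
  show "if a = - 2 \<and> b = 0
      then poly_inf (quartic a b) = 0 \<and> sonc_bound (quartic a b) = 0
      else poly_inf (quartic a b) = - \<infinity> \<and> sonc_bound (quartic a b) = - \<infinity>" if "a \<le> - 2"
  proof (cases "a = - 2 \<and> b = 0")
    case True
    then have "poly_inf (quartic a b) = 0" "0 \<le> sonc_bound (quartic a b)"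
      using poly_inf_quartic_diagonal[of a b 0] sonc_bound_quartic_ge_small[of a b 0]
      by (simp_all add: zero_ereal_def)
    with True show ?thesis
      using sonc_bound_le_poly_inf[of "quartic a b"] by auto
  next
    case False
    with poly_inf_quartic_unbounded[OF that False] show ?thesis
      using sonc_bound_le_poly_inf[of "quartic a b"] by auto
  qed
qed

end
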